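(* Let $(\Omega,\Sigma,\mu)$ be an atomless probability space, let $p\in[0,1]$, and let $W\colon\Omega^2\to[0,1]$ be symmetric and measurable. Suppose that $$\iint_{U\times U}W(x,y)\,\mathrm d\mu(x)\,\mathrm d\mu(y)\geq p\,\mu(U)^2\qquad\text{for every }U\in\Sigma.$$ Then for every bounded measurable $f\colon\Omega\to[0,\infty)$, $$\iint_{\Omega^2}f(x)W(x,y)f(y)\,\mathrm d\mu(x)\,\mathrm d\mu(y)\geq p\,\lVert f\rVert_1^{2}.$$
   Context: $\Omega^2$ carries the product $\sigma$-algebra $\Sigma\otimes\Sigma$ and the product measure $\mu\times\mu$. Symmetric means $W(x,y)=W(y,x)$. $\lVert f\rVert_1=\int_\Omega|f|\,\mathrm d\mu$. Atomless means that every $D\in\Sigma$ with $\mu(D)>0$ can be divided into two disjoint measurable sets of positive measure. *)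

theory Defs
  imports "HOL-Probability.Probability"
begin

definition atomless :: "'a measure \<Rightarrow> bool" where
  "atomless M \<longleftrightarrow>
     (\<forall>D \<in> sets M. emeasure M D > 0 \<longrightarrow>
        (\<exists>A \<in> sets M. \<exists>B \<in> sets M.
           A \<union> B = D \<and> A \<inter> B = {} \<and> emeasure M A > 0 \<and> emeasure M B > 0))"

end

theory Submission
  imports Defs
begin

text \<open>
  The hypothesis is the asserted inequality for \<open>f\<close> the indicator of a set, so the theorem
  says that indicators already decide it. After rescaling, \<open>f = g\<close> takes values in
  \<open>[0, 1]\<close>. In an atomless space such a \<open>g\<close> can be imitated by a set \<open>U\<close> that occupies,
  inside each of finitely many parts of the space, the mass that \<open>g\<close> prescribes there: given
  finitely many measurable test sets \<open>P\<close>, some \<open>U\<close> satisfies \<open>\<mu>(U \<inter> P) = \<integral>\<^sub>P g\<close> for all of them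
  (lemma \<open>ex_mimics\<close>, which rests on Sierpinski's theorem that measures of subsets take all
  intermediate values, lemma \<open>atomless_subset_of_measure\<close>).

  A rectangle \<open>A \<times> B\<close> has the same mass under \<open>g(x) g(y)\<close> as under the indicator of \<open>U \<times> U\<close> as soon
  as \<open>U\<close> imitates \<open>g\<close> on \<open>A\<close> and on \<open>B\<close>. Combinations of rectangles are dense in
  \<open>L\<^sup>1(\<mu> \<times> \<mu>)\<close>, and both weights are bounded by 1, so for every integrable kernel and every error
  \<open>e\<close> finitely many test sets suffice to make the two integrals of the kernel agree up to \<open>e\<close>
  (proposition \<open>finitely_tested_integrable\<close>). With the whole space among the test sets,
  \<open>\<mu>(U) = \<integral> g\<close>, and the hypothesis for \<open>U\<close> becomes the claim for \<open>g\<close> up to \<open>e\<close>.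
\<close>

section \<open>Subsets of prescribed measure\<close>

text \<open>
  Of two disjoint parts of positive measure one has at most half the measure, so repeated
  division gives subsets of positive measure as small as desired.
\<close>

lemma (in finite_measure) atomless_small_subset:
  assumes "atomless M" and D: "D \<in> sets M" "measure M D > 0" and "e > 0"
  shows "\<exists>C\<in>sets M. C \<subseteq> D \<and> 0 < measure M C \<and> measure M C < e"
proof -
  have halve: "\<exists>C\<in>sets M. C \<subseteq> E \<and> 0 < measure M C \<and> measure M C \<le> measure M E / 2"
    if E: "E \<in> sets M" "measure M E > 0" for E
  proof -
    have "emeasure M E > 0"
      using E by (simp add: emeasure_eq_measure)
    then obtain A B where AB: "A \<in> sets M" "B \<in> sets M" "A \<union> B = E" "A \<inter> B = {}"
      "emeasure M A > 0" "emeasure M B > 0"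
      using \<open>atomless M\<close> E(1) unfolding atomless_def by meson
    then have "measure M A > 0" "measure M B > 0"
      by (simp_all add: emeasure_eq_measure)
    moreover have "measure M E = measure M A + measure M B"
      using AB finite_measure_Union by metis
    ultimately have "(0 < measure M A \<and> measure M A \<le> measure M E / 2)
        \<or> (0 < measure M B \<and> measure M B \<le> measure M E / 2)"
      by linarith
    then show ?thesis
      using AB by blast
  qed
  have pow: "\<exists>C\<in>sets M. C \<subseteq> D \<and> 0 < measure M C \<and> measure M C \<le> measure M D * (1/2)^n" for n
  proof (induction n)
    case 0
    show ?case using D by auto
  next
    case (Suc n)
    then obtain C where C: "C \<in> sets M" "C \<subseteq> D" "0 < measure M C"
      "measure M C \<le> measure M D * (1/2)^n"
      by auto
    obtain C' where "C' \<in> sets M" "C' \<subseteq> C" "0 < measure M C'" "measure M C' \<le> measure M C / 2"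
      using halve[OF C(1,3)] by auto
    then show ?case
      using C by (intro bexI[of _ C']) auto
  qed
  obtain n where "(1/2::real)^n < e / measure M D"
    using real_arch_pow_inv[of "e / measure M D" "1/2"] \<open>e > 0\<close> D by auto
  then have "measure M D * (1/2)^n < e"
    using D by (simp add: field_simps)
  then show ?thesis
    using pow[of n] by (meson le_less_trans)
qed

text \<open>
  Sierpinski's theorem, by exhaustion from below: enlarge a set again and again by a piece
  that still fits under \<open>t\<close> and has at least half of the largest possible measure. If the union
  of these sets fell short of \<open>t\<close>, some piece of positive measure would fit at every stage, so every
  increment would be at least a fixed positive number, although the increments tend to 0.
\<close>

lemma (in finite_measure) atomless_subset_of_measure:
  assumes "atomless M" and D: "D \<in> sets M" and t: "0 \<le> t" "t \<le> measure M D"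
  shows "\<exists>B\<in>sets M. B \<subseteq> D \<and> measure M B = t"
proof -
  let ?ok = "\<lambda>B. B \<in> sets M \<and> B \<subseteq> D \<and> measure M B \<le> t"
  let ?room = "\<lambda>B. {C \<in> sets M. C \<subseteq> D - B \<and> measure M B + measure M C \<le> t}"
  let ?next = "\<lambda>B B'. B \<subseteq> B' \<and> (\<forall>C\<in>?room B. measure M C \<le> 2 * (measure M B' - measure M B))"
  \<comment> \<open>The factor 2 allows for a supremum of the available measures that is not attained.\<close>
  have step: "\<exists>B'. ?ok B' \<and> ?next B B'"
    if B: "?ok B" for B
  proof -
    let ?s = "Sup (measure M ` ?room B)"
    have ne: "{} \<in> ?room B"
      using B by auto
    have bdd: "bdd_above (measure M ` ?room B)"
      by (intro bdd_aboveI[of _ "measure M (space M)"]) (auto intro: bounded_measure)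
    have up: "measure M C \<le> ?s" if "C \<in> ?room B" for C
      by (rule cSup_upper[OF _ bdd]) (use that in blast)
    have "\<exists>C\<in>?room B. ?s \<le> 2 * measure M C"
    proof (cases "?s > 0")
      case True
      then have "?s / 2 < ?s" by simp
      then obtain C where "C \<in> ?room B" "?s / 2 < measure M C"
        using less_cSup_iff[OF _ bdd] ne by blast
      then show ?thesis by (intro bexI[of _ C]) auto
    next
      case False
      then show ?thesis using ne by (intro bexI[of _ "{}"]) auto
    qed
    then obtain C where C: "C \<in> ?room B" "?s \<le> 2 * measure M C" by blast
    have "measure M (B \<union> C) = measure M B + measure M C"
      using B C by (intro finite_measure_Union) auto
    then have "measure M E \<le> 2 * (measure M (B \<union> C) - measure M B)" if "E \<in> ?room B" for E
      using order_trans[OF up[OF that] C(2)] by simp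
    moreover have "?ok (B \<union> C)"
      using B C(1) \<open>measure M (B \<union> C) = _\<close> by simp blast
    ultimately show ?thesis
      by (intro exI[of _ "B \<union> C"]) blast
  qed
  have "\<exists>B. \<forall>n. ?ok (B n) \<and> ?next (B n) (B (Suc n))"
  proof (rule dependent_nat_choice[where P = "\<lambda>_. ?ok" and Q = "\<lambda>_. ?next"])
    show "\<exists>B. ?ok B" using t by (intro exI[of _ "{}"]) simp
    show "\<exists>B'. ?ok B' \<and> ?next B B'" if "?ok B" for B and n :: nat
      using step[OF that] .
  qed
  then obtain B where ok: "\<And>n. ?ok (B n)" and inc: "\<And>n. B n \<subseteq> B (Suc n)"
    and greedy: "\<And>n C. C \<in> ?room (B n) \<Longrightarrow> measure M C \<le> 2 * (measure M (B (Suc n)) - measure M (B n))"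
    by blast
  let ?B = "\<Union>n. B n"
  have lim: "(\<lambda>n. measure M (B n)) \<longlonglongrightarrow> measure M ?B"
  proof (rule finite_Lim_measure_incseq)
    show "range B \<subseteq> sets M" using ok by blast
    show "incseq B" by (rule incseq_SucI) (rule inc)
  qed
  have B: "?B \<in> sets M" "?B \<subseteq> D"
    using ok by auto
  have le: "measure M ?B \<le> t"
    using lim ok by (intro LIMSEQ_le_const2[OF lim]) auto
  have "measure M ?B = t"
  proof (rule ccontr)
    assume "measure M ?B \<noteq> t"
    with le have less: "measure M ?B < t" by simp
    have "measure M (D - ?B) = measure M D - measure M ?B"
      using B D by (intro finite_measure_Diff) auto
    with less t have "measure M (D - ?B) > 0" by simp
    \<comment> \<open>This piece fits on top of the union, hence on top of every stage.\<close>
    then obtain C where C: "C \<in> sets M" "C \<subseteq> D - ?B" "0 < measure M C"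
      "measure M C < t - measure M ?B"
      using atomless_small_subset[OF \<open>atomless M\<close>, of "D - ?B" "t - measure M ?B"] less B D by auto
    have "measure M C \<le> 2 * (measure M (B (Suc n)) - measure M (B n))" for n
    proof (rule greedy)
      have "measure M (B n) \<le> measure M ?B"
        using B by (intro finite_measure_mono) auto
      then show "C \<in> ?room (B n)" using C by auto
    qed
    moreover have "(\<lambda>n. 2 * (measure M (B (Suc n)) - measure M (B n))) \<longlonglongrightarrow> 2 * (measure M ?B - measure M ?B)"
      by (intro tendsto_intros lim LIMSEQ_Suc[OF lim])
    ultimately have "measure M C \<le> 2 * (measure M ?B - measure M ?B)"
      by (intro LIMSEQ_le_const) auto
    with C show False by simp
  qed
  then show ?thesis using B by blast
qed

section \<open>Replacing a density by a set\<close>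

definition mimics :: "'a measure \<Rightarrow> ('a \<Rightarrow> real) \<Rightarrow> 'a set set \<Rightarrow> 'a set \<Rightarrow> bool" where
  "mimics M g F U \<longleftrightarrow> U \<in> sets M \<and> (\<forall>P\<in>F. measure M (U \<inter> P) = (LINT x:P|M. g x))"

lemma mimics_subset: "mimics M g F U \<Longrightarrow> G \<subseteq> F \<Longrightarrow> mimics M g G U"
  unfolding mimics_def by blast

text \<open>
  For one set \<open>D\<close> this is Sierpinski's theorem. A new test set \<open>P\<close> splits \<open>D\<close> into two parts that
  are treated separately. Prescribing also the total measure of \<open>U\<close> makes the induction
  work: the total of the part inside \<open>P\<close> is the value required by \<open>P\<close> itself.
\<close>

lemma (in finite_measure) ex_mimics_within:
  assumes "atomless M" and g [measurable]: "g \<in> borel_measurable M"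
    and g01: "\<And>x. x \<in> space M \<Longrightarrow> 0 \<le> g x \<and> g x \<le> 1"
    and "finite F" "F \<subseteq> sets M" "D \<in> sets M"
  shows "\<exists>U\<in>sets M. U \<subseteq> D \<and> measure M U = (LINT x:D|M. g x)
    \<and> (\<forall>P\<in>F. measure M (U \<inter> P) = (LINT x:D \<inter> P|M. g x))"
  using assms(4,5,6)
proof (induction F arbitrary: D rule: finite_induct)
  case empty
  note [measurable] = \<open>D \<in> sets M\<close>
  have "0 \<le> (LINT x:D|M. g x)"
    unfolding set_lebesgue_integral_def
    by (intro integral_nonneg_AE AE_I2) (use g01 in \<open>auto split: split_indicator\<close>)
  moreover have "(LINT x:D|M. g x) \<le> (\<integral>x. indicator D x \<partial>M)"
    unfolding set_lebesgue_integral_def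
  proof (rule integral_mono)
    show "integrable M (\<lambda>x. indicator D x *\<^sub>R g x)"
      by (rule integrable_const_bound[where B = 1])
        (use g01 in \<open>auto intro!: AE_I2 split: split_indicator\<close>)
  qed (use g01 in \<open>auto split: split_indicator simp: integrable_indicator_iff emeasure_eq_measure\<close>)
  ultimately show ?case
    using atomless_subset_of_measure[OF \<open>atomless M\<close> \<open>D \<in> sets M\<close>] by auto
next
  case (insert P F)
  note [measurable] = \<open>D \<in> sets M\<close>
  have P [measurable]: "P \<in> sets M" and F: "\<And>Q. Q \<in> F \<Longrightarrow> Q \<in> sets M"
    using insert.prems by auto
  have int: "set_integrable M E g" if [measurable]: "E \<in> sets M" for E
    unfolding set_integrable_def
    by (rule integrable_const_bound[where B = 1])
        (use g01 in \<open>auto intro!: AE_I2 split: split_indicator\<close>)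
  have split: "(LINT x:E|M. g x) = (LINT x:E \<inter> P|M. g x) + (LINT x:E - P|M. g x)" if [measurable]: "E \<in> sets M" for E
  proof -
    have "(E \<inter> P) \<inter> (E - P) = {}" by blast
    from set_integral_Un[OF this, of M g] show ?thesis
      by (simp add: int Int_Diff_Un)
  qed
  obtain U1 where U1: "U1 \<in> sets M" "U1 \<subseteq> D \<inter> P" "measure M U1 = (LINT x:D \<inter> P|M. g x)"
    "\<And>Q. Q \<in> F \<Longrightarrow> measure M (U1 \<inter> Q) = (LINT x:(D \<inter> P) \<inter> Q|M. g x)"
    using insert.IH[of "D \<inter> P"] insert.prems by auto
  obtain U2 where U2: "U2 \<in> sets M" "U2 \<subseteq> D - P" "measure M U2 = (LINT x:D - P|M. g x)"
    "\<And>Q. Q \<in> F \<Longrightarrow> measure M (U2 \<inter> Q) = (LINT x:(D - P) \<inter> Q|M. g x)"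
    using insert.IH[of "D - P"] insert.prems by auto
  show ?case
  proof (intro bexI[of _ "U1 \<union> U2"] conjI ballI)
    show "U1 \<union> U2 \<in> sets M" "U1 \<union> U2 \<subseteq> D" using U1 U2 by auto
    have "measure M (U1 \<union> U2) = measure M U1 + measure M U2"
      using U1 U2 by (intro finite_measure_Union) auto
    then show "measure M (U1 \<union> U2) = (LINT x:D|M. g x)"
      using U1 U2 split[of D] by simp
    fix Q assume Q: "Q \<in> insert P F"
    show "measure M ((U1 \<union> U2) \<inter> Q) = (LINT x:D \<inter> Q|M. g x)"
    proof (cases "Q = P")
      case True
      have "(U1 \<union> U2) \<inter> P = U1" using U1 U2 by auto
      then show ?thesis using True U1 by simp
    next
      case False
      with Q have QF: "Q \<in> F" by simp
      then have [measurable]: "Q \<in> sets M" by (rule F)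
      have "measure M ((U1 \<union> U2) \<inter> Q) = measure M (U1 \<inter> Q) + measure M (U2 \<inter> Q)"
        unfolding Int_Un_distrib2 using U1 U2 by (intro finite_measure_Union) auto
      also have "\<dots> = (LINT x:(D \<inter> Q) \<inter> P|M. g x) + (LINT x:(D \<inter> Q) - P|M. g x)"
      proof -
        have "(D \<inter> P) \<inter> Q = (D \<inter> Q) \<inter> P" "(D - P) \<inter> Q = (D \<inter> Q) - P" by blast+
        then show ?thesis using U1(4)[OF QF] U2(4)[OF QF] by simp
      qed
      also have "\<dots> = (LINT x:D \<inter> Q|M. g x)"
        using split[of "D \<inter> Q"] by simp
      finally show ?thesis .
    qed
  qed
qed

corollary (in finite_measure) ex_mimics:
  assumes "atomless M" "g \<in> borel_measurable M"
    and "\<And>x. x \<in> space M \<Longrightarrow> 0 \<le> g x \<and> g x \<le> 1"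
    and "finite F" "F \<subseteq> sets M"
  shows "\<exists>U. mimics M g F U"
proof -
  obtain U where U: "U \<in> sets M" "\<forall>P\<in>F. measure M (U \<inter> P) = (LINT x:space M \<inter> P|M. g x)"
    using ex_mimics_within[OF assms, of "space M"] by auto
  moreover have "space M \<inter> P = P" if "P \<in> F" for P
    using assms(5) that sets.sets_into_space by blast
  ultimately show ?thesis
    unfolding mimics_def by (intro exI[of _ U]) auto
qed

section \<open>Kernels see only finitely many test sets\<close>

text \<open>
  The integral of a kernel against \<open>defect g U\<close> is the error made by replacing the
  density \<open>g\<close> by the set \<open>U\<close> in both variables.
\<close>

definition defect :: "('a \<Rightarrow> real) \<Rightarrow> 'a set \<Rightarrow> 'a \<times> 'a \<Rightarrow> real" where
  "defect g U z = g (fst z) * g (snd z) - indicator U (fst z) * indicator U (snd z)"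

text \<open>
  A form of weak continuity at \<open>g\<close> of the quadratic form with kernel \<open>H\<close>. It speaks only of
  sets \<open>U\<close> that agree exactly with \<open>g\<close> on the test sets, because in an atomless space and for
  measurable \<open>g\<close> with values in \<open>[0, 1]\<close> such sets exist.
\<close>

definition finitely_tested :: "'a measure \<Rightarrow> ('a \<Rightarrow> real) \<Rightarrow> ('a \<times> 'a \<Rightarrow> real) \<Rightarrow> bool" where
  "finitely_tested M g H \<longleftrightarrow> (\<forall>e>0. \<exists>F. finite F \<and> F \<subseteq> sets M \<and>
     (\<forall>U. mimics M g F U \<longrightarrow> \<bar>\<integral>z. H z * defect g U z \<partial>(M \<Otimes>\<^sub>M M)\<bar> \<le> e))"

text \<open>
  A function \<open>g\<close> with values in \<open>[0, 1]\<close>, read as a set to which the point \<open>x\<close> belongs to the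
  degree \<open>g x\<close>.
\<close>

locale fractional_set = prob_space M for M :: "'a measure" +
  fixes g :: "'a \<Rightarrow> real"
  assumes g_measurable [measurable]: "g \<in> borel_measurable M"
    and g_nonneg: "x \<in> space M \<Longrightarrow> 0 \<le> g x"
    and g_le_1: "x \<in> space M \<Longrightarrow> g x \<le> 1"
begin

sublocale pair: pair_prob_space M M ..

text \<open>
  This bound turns closeness of kernels in \<open>L\<^sup>1\<close> into closeness of their errors, uniformly in \<open>U\<close>.
\<close>

lemma abs_defect_le:
  assumes "z \<in> space (M \<Otimes>\<^sub>M M)"
  shows "\<bar>defect g U z\<bar> \<le> 1"
proof -
  have "fst z \<in> space M" "snd z \<in> space M"
    using assms by (auto simp: space_pair_measure)
  then have "0 \<le> g (fst z) * g (snd z)" "g (fst z) * g (snd z) \<le> 1"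
    using g_nonneg g_le_1 by (auto intro: mult_le_one)
  then show ?thesis
    by (auto simp: defect_def split: split_indicator)
qed

lemma abs_mult_defect_le: "z \<in> space (M \<Otimes>\<^sub>M M) \<Longrightarrow> \<bar>h * defect g U z\<bar> \<le> \<bar>h\<bar>"
  using mult_left_mono[OF abs_defect_le, of z "\<bar>h\<bar>" U] by (simp add: abs_mult)

lemma defect_measurable [measurable]:
  assumes [measurable]: "U \<in> sets M"
  shows "defect g U \<in> borel_measurable (M \<Otimes>\<^sub>M M)"
  unfolding defect_def by measurable

lemma integrable_mult_defect:
  assumes H: "integrable (M \<Otimes>\<^sub>M M) H" and [measurable]: "U \<in> sets M"
  shows "integrable (M \<Otimes>\<^sub>M M) (\<lambda>z. H z * defect g U z)"
  using H
  by (rule Bochner_Integration.integrable_bound)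
    (use borel_measurable_integrable[OF H] in \<open>auto intro!: AE_I2 abs_mult_defect_le\<close>)

lemma finitely_tested_zeroI:
  assumes "finite F" "F \<subseteq> sets M"
    and "\<And>U. mimics M g F U \<Longrightarrow> (\<integral>z. H z * defect g U z \<partial>(M \<Otimes>\<^sub>M M)) = 0"
  shows "finitely_tested M g H"
  unfolding finitely_tested_def using assms by (intro allI impI exI[of _ F]) auto

text \<open>
  The test sets of a kernel within \<open>e / 2\<close> of \<open>H\<close> in \<open>L\<^sup>1\<close> serve for \<open>H\<close>: changing the kernel
  changes the error by at most \<open>e / 2\<close>, whatever \<open>U\<close> is.
\<close>

lemma finitely_tested_limit:
  assumes H: "integrable (M \<Otimes>\<^sub>M M) H"
    and approx: "\<And>e. e > 0 \<Longrightarrow> \<exists>K. integrable (M \<Otimes>\<^sub>M M) K \<and> finitely_tested M g K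
        \<and> (\<integral>z. \<bar>H z - K z\<bar> \<partial>(M \<Otimes>\<^sub>M M)) \<le> e"
  shows "finitely_tested M g H"
  unfolding finitely_tested_def
proof (intro allI impI)
  fix e :: real assume "e > 0"
  then have e2: "e / 2 > 0" by simp
  from approx[OF e2] obtain K where K: "integrable (M \<Otimes>\<^sub>M M) K" "finitely_tested M g K"
    and HK: "(\<integral>z. \<bar>H z - K z\<bar> \<partial>(M \<Otimes>\<^sub>M M)) \<le> e / 2"
    by blast
  from K(2) e2 obtain F where F: "finite F" "F \<subseteq> sets M"
    "\<And>U. mimics M g F U \<Longrightarrow> \<bar>\<integral>z. K z * defect g U z \<partial>(M \<Otimes>\<^sub>M M)\<bar> \<le> e / 2"
    unfolding finitely_tested_def by blast
  show "\<exists>F. finite F \<and> F \<subseteq> sets M \<and>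
     (\<forall>U. mimics M g F U \<longrightarrow> \<bar>\<integral>z. H z * defect g U z \<partial>(M \<Otimes>\<^sub>M M)\<bar> \<le> e)"
  proof (intro exI[of _ F] conjI allI impI F)
    fix U assume U: "mimics M g F U"
    then have [measurable]: "U \<in> sets M" by (simp add: mimics_def)
    have intD: "integrable (M \<Otimes>\<^sub>M M) (\<lambda>z. (H z - K z) * defect g U z)"
      using H K by (intro integrable_mult_defect) auto
    have "\<bar>\<integral>z. (H z - K z) * defect g U z \<partial>(M \<Otimes>\<^sub>M M)\<bar> \<le> (\<integral>z. \<bar>H z - K z\<bar> \<partial>(M \<Otimes>\<^sub>M M))"
      by (rule order_trans[OF integral_abs_bound], rule integral_mono)
         (use H K(1) intD in \<open>auto intro: abs_mult_defect_le\<close>)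
    moreover have "(\<integral>z. (H z - K z) * defect g U z \<partial>(M \<Otimes>\<^sub>M M))
        = (\<integral>z. H z * defect g U z \<partial>(M \<Otimes>\<^sub>M M)) - (\<integral>z. K z * defect g U z \<partial>(M \<Otimes>\<^sub>M M))"
      unfolding left_diff_distrib
      using H K by (intro Bochner_Integration.integral_diff integrable_mult_defect) auto
    ultimately show "\<bar>\<integral>z. H z * defect g U z \<partial>(M \<Otimes>\<^sub>M M)\<bar> \<le> e"
      using F(3)[OF U] HK by linarith
  qed
qed

text \<open>
  Dominated convergence is convergence in \<open>L\<^sup>1\<close>. This one closure property covers both countable
  unions of sets and limits of simple functions.
\<close>

lemma finitely_tested_dominated_limit:
  assumes s: "\<And>i. integrable (M \<Otimes>\<^sub>M M) (s i)" "\<And>i. finitely_tested M g (s i)"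
    and lim: "\<And>z. z \<in> space (M \<Otimes>\<^sub>M M) \<Longrightarrow> (\<lambda>i. s i z) \<longlonglongrightarrow> H z"
    and dom: "\<And>i z. z \<in> space (M \<Otimes>\<^sub>M M) \<Longrightarrow> \<bar>s i z\<bar> \<le> w z"
    and int: "integrable (M \<Otimes>\<^sub>M M) H" "integrable (M \<Otimes>\<^sub>M M) w"
  shows "finitely_tested M g H"
proof (rule finitely_tested_limit[OF int(1)])
  fix e :: real assume "e > 0"
  note [measurable] = borel_measurable_integrable[OF s(1)] borel_measurable_integrable[OF int(1)]
  have "(\<lambda>i. \<integral>z. \<bar>H z - s i z\<bar> \<partial>(M \<Otimes>\<^sub>M M)) \<longlonglongrightarrow> (\<integral>z. 0 \<partial>(M \<Otimes>\<^sub>M M))"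
  proof (rule integral_dominated_convergence[where w = "\<lambda>z. \<bar>H z\<bar> + w z"])
    show "AE z in M \<Otimes>\<^sub>M M. (\<lambda>i. \<bar>H z - s i z\<bar>) \<longlonglongrightarrow> 0"
    proof (rule AE_I2)
      fix z assume "z \<in> space (M \<Otimes>\<^sub>M M)"
      from tendsto_rabs[OF tendsto_diff[OF tendsto_const[of "H z"] lim[OF this]]]
      show "(\<lambda>i. \<bar>H z - s i z\<bar>) \<longlonglongrightarrow> 0" by simp
    qed
    show "AE z in M \<Otimes>\<^sub>M M. norm \<bar>H z - s i z\<bar> \<le> \<bar>H z\<bar> + w z" for i
      by (rule AE_I2) (use dom[of _ i] in \<open>fastforce\<close>)
  qed (use int in auto)
  then have "\<forall>\<^sub>F i in sequentially. (\<integral>z. \<bar>H z - s i z\<bar> \<partial>(M \<Otimes>\<^sub>M M)) < e"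
    using \<open>e > 0\<close> by (auto dest: order_tendstoD(2))
  then obtain i where "(\<integral>z. \<bar>H z - s i z\<bar> \<partial>(M \<Otimes>\<^sub>M M)) < e"
    by (auto simp: eventually_sequentially)
  then show "\<exists>K. integrable (M \<Otimes>\<^sub>M M) K \<and> finitely_tested M g K
        \<and> (\<integral>z. \<bar>H z - K z\<bar> \<partial>(M \<Otimes>\<^sub>M M)) \<le> e"
    using s by (intro exI[of _ "s i"]) auto
qed

lemma finitely_tested_add:
  assumes H: "integrable (M \<Otimes>\<^sub>M M) H" "finitely_tested M g H"
    and K: "integrable (M \<Otimes>\<^sub>M M) K" "finitely_tested M g K"
  shows "finitely_tested M g (\<lambda>z. H z + K z)"
  unfolding finitely_tested_def
proof (intro allI impI)
  fix e :: real assume "e > 0"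
  then have e2: "e / 2 > 0" by simp
  from H(2) e2 obtain F where F: "finite F" "F \<subseteq> sets M"
    "\<And>U. mimics M g F U \<Longrightarrow> \<bar>\<integral>z. H z * defect g U z \<partial>(M \<Otimes>\<^sub>M M)\<bar> \<le> e / 2"
    unfolding finitely_tested_def by blast
  from K(2) e2 obtain G where G: "finite G" "G \<subseteq> sets M"
    "\<And>U. mimics M g G U \<Longrightarrow> \<bar>\<integral>z. K z * defect g U z \<partial>(M \<Otimes>\<^sub>M M)\<bar> \<le> e / 2"
    unfolding finitely_tested_def by blast
  show "\<exists>F. finite F \<and> F \<subseteq> sets M \<and>
     (\<forall>U. mimics M g F U \<longrightarrow> \<bar>\<integral>z. (H z + K z) * defect g U z \<partial>(M \<Otimes>\<^sub>M M)\<bar> \<le> e)"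
  proof (intro exI[of _ "F \<union> G"] conjI allI impI)
    fix U assume U: "mimics M g (F \<union> G) U"
    then have "U \<in> sets M" by (simp add: mimics_def)
    then have "(\<integral>z. (H z + K z) * defect g U z \<partial>(M \<Otimes>\<^sub>M M))
        = (\<integral>z. H z * defect g U z \<partial>(M \<Otimes>\<^sub>M M)) + (\<integral>z. K z * defect g U z \<partial>(M \<Otimes>\<^sub>M M))"
      unfolding distrib_right
      using H K by (intro Bochner_Integration.integral_add integrable_mult_defect) auto
    then show "\<bar>\<integral>z. (H z + K z) * defect g U z \<partial>(M \<Otimes>\<^sub>M M)\<bar> \<le> e"
      using F(3)[of U] G(3)[of U] mimics_subset[OF U] by fastforce
  qed (use F G in auto)
qed

lemma finitely_tested_cmult:
  assumes H: "finitely_tested M g H"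
  shows "finitely_tested M g (\<lambda>z. c * H z)"
  unfolding finitely_tested_def
proof (intro allI impI)
  fix e :: real assume "e > 0"
  \<comment> \<open>The summand 1 avoids a separate case for a zero factor.\<close>
  then have "e / (\<bar>c\<bar> + 1) > 0" by simp
  with H obtain F where F: "finite F" "F \<subseteq> sets M"
    "\<And>U. mimics M g F U \<Longrightarrow> \<bar>\<integral>z. H z * defect g U z \<partial>(M \<Otimes>\<^sub>M M)\<bar> \<le> e / (\<bar>c\<bar> + 1)"
    unfolding finitely_tested_def by blast
  show "\<exists>F. finite F \<and> F \<subseteq> sets M \<and>
     (\<forall>U. mimics M g F U \<longrightarrow> \<bar>\<integral>z. (c * H z) * defect g U z \<partial>(M \<Otimes>\<^sub>M M)\<bar> \<le> e)"
  proof (intro exI[of _ F] conjI allI impI F)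
    fix U assume U: "mimics M g F U"
    have "\<bar>\<integral>z. (c * H z) * defect g U z \<partial>(M \<Otimes>\<^sub>M M)\<bar> = \<bar>c\<bar> * \<bar>\<integral>z. H z * defect g U z \<partial>(M \<Otimes>\<^sub>M M)\<bar>"
      by (simp add: mult.assoc abs_mult)
    also have "\<dots> \<le> (\<bar>c\<bar> + 1) * (e / (\<bar>c\<bar> + 1))"
      using F(3)[OF U] by (intro mult_mono) auto
    also have "\<dots> = e" by (simp add: add_nonneg_eq_0_iff)
    finally show "\<bar>\<integral>z. (c * H z) * defect g U z \<partial>(M \<Otimes>\<^sub>M M)\<bar> \<le> e" .
  qed
qed

lemma integral_rectangle:
  fixes h :: "'a \<Rightarrow> real"
  assumes [measurable]: "A \<in> sets M" "B \<in> sets M" "h \<in> borel_measurable M"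
    and h: "\<And>x. x \<in> space M \<Longrightarrow> 0 \<le> h x \<and> h x \<le> 1"
  shows "(\<integral>z. indicator (A \<times> B) z * (h (fst z) * h (snd z)) \<partial>(M \<Otimes>\<^sub>M M))
    = (LINT x:A|M. h x) * (LINT x:B|M. h x)"
proof -
  have int: "integrable (M \<Otimes>\<^sub>M M) (\<lambda>z. indicator (A \<times> B) z * (h (fst z) * h (snd z)))"
    by (rule pair.P.integrable_const_bound[where B = 1])
       (use h in \<open>auto intro!: AE_I2 mult_le_one simp: space_pair_measure split: split_indicator\<close>)
  have "(\<integral>z. indicator (A \<times> B) z * (h (fst z) * h (snd z)) \<partial>(M \<Otimes>\<^sub>M M))
      = (\<integral>x. \<integral>y. (indicator A x * h x) * (indicator B y * h y) \<partial>M \<partial>M)"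
    using pair.integral_fst'[OF int] by (simp add: indicator_times mult_ac)
  also have "\<dots> = (LINT x:A|M. h x) * (LINT x:B|M. h x)"
    by (simp add: set_lebesgue_integral_def)
  finally show ?thesis .
qed

text \<open>
  On a rectangle both weights factor, so testing on the two sides makes the error vanish.
\<close>

lemma finitely_tested_rectangle:
  assumes [measurable]: "A \<in> sets M" "B \<in> sets M"
  shows "finitely_tested M g (indicator (A \<times> B))"
proof (rule finitely_tested_zeroI[of "{A, B}"])
  fix U assume U: "mimics M g {A, B} U"
  then have [measurable]: "U \<in> sets M" by (simp add: mimics_def)
  let ?u = "indicator U :: 'a \<Rightarrow> real"
  have meas: "(LINT x:P|M. ?u x) = measure M (U \<inter> P)" if "P \<in> sets M" for P
    using that by (simp add: set_lebesgue_integral_def indicator_inter_arith[symmetric] Int_commute)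
  have int: "integrable (M \<Otimes>\<^sub>M M) (\<lambda>z. indicator (A \<times> B) z * (h (fst z) * h (snd z)))"
    if [measurable]: "h \<in> borel_measurable M" and "\<And>x. x \<in> space M \<Longrightarrow> 0 \<le> h x \<and> h x \<le> 1"
    for h :: "'a \<Rightarrow> real"
    by (rule pair.P.integrable_const_bound[where B = 1])
       (use that in \<open>auto intro!: AE_I2 mult_le_one simp: space_pair_measure split: split_indicator\<close>)
  have "(\<integral>z. indicator (A \<times> B) z * defect g U z \<partial>(M \<Otimes>\<^sub>M M))
      = (\<integral>z. indicator (A \<times> B) z * (g (fst z) * g (snd z)) \<partial>(M \<Otimes>\<^sub>M M))
        - (\<integral>z. indicator (A \<times> B) z * (?u (fst z) * ?u (snd z)) \<partial>(M \<Otimes>\<^sub>M M))"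
    unfolding defect_def right_diff_distrib
    by (intro Bochner_Integration.integral_diff int) (auto simp: g_nonneg g_le_1)
  also have "\<dots> = (LINT x:A|M. g x) * (LINT x:B|M. g x) - measure M (U \<inter> A) * measure M (U \<inter> B)"
    by (simp add: integral_rectangle g_nonneg g_le_1 meas)
  also have "\<dots> = 0"
    using U by (simp add: mimics_def)
  finally show "(\<integral>z. indicator (A \<times> B) z * defect g U z \<partial>(M \<Otimes>\<^sub>M M)) = 0" .
qed auto

text \<open>
  Rectangles form a generator of the product \<open>\<sigma>\<close>-algebra that is closed under intersection, so it
  suffices to pass to complements and to countable disjoint unions.
\<close>

lemma finitely_tested_indicator:
  assumes "X \<in> sets (M \<Otimes>\<^sub>M M)"
  shows "finitely_tested M g (indicator X)"
  using Int_stable_pair_measure_generator pair_measure_closed assms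
  unfolding sets_pair_measure
proof (induction rule: sigma_sets_induct_disjoint)
  case (basic X)
  then show ?case by (auto intro: finitely_tested_rectangle)
next
  case empty
  show ?case by (rule finitely_tested_zeroI[of "{}"]) auto
next
  case (compl X)
  then have X [measurable]: "X \<in> sets (M \<Otimes>\<^sub>M M)" by (simp add: sets_pair_measure)
  have "finitely_tested M g (\<lambda>z. indicator (space M \<times> space M) z + (- 1) * indicator X z)"
    using compl by (intro finitely_tested_add finitely_tested_cmult finitely_tested_rectangle)
      (auto simp: pair.P.emeasure_eq_measure)
  also have "(\<lambda>z. indicator (space M \<times> space M) z + (- 1) * indicator X z)
      = (indicator (space M \<times> space M - X) :: _ \<Rightarrow> real)"
    using sets.sets_into_space[OF X] by (auto simp: space_pair_measure fun_eq_iff split: split_indicator)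
  finally show ?case .
next
  case (union X)
  then have X [measurable]: "\<And>i. X i \<in> sets (M \<Otimes>\<^sub>M M)" by (auto simp: sets_pair_measure)
  have int: "integrable (M \<Otimes>\<^sub>M M) (indicator Y :: _ \<Rightarrow> real)" if "Y \<in> sets (M \<Otimes>\<^sub>M M)" for Y
    using that by (simp add: pair.P.emeasure_eq_measure)
  have fin: "finitely_tested M g (\<lambda>z. \<Sum>i<n. indicator (X i) z)" for n
  proof (induction n)
    case 0
    show ?case by (rule finitely_tested_zeroI[of "{}"]) auto
  next
    case (Suc n)
    then show ?case
      using union int by (auto intro!: finitely_tested_add)
  qed
  have partial: "(\<Sum>i<n. indicator (X i) z) = (indicator (\<Union>i<n. X i) z :: real)" for n z
    using union(1) by (intro indicator_UN_disjoint[symmetric]) (auto simp: disjoint_family_on_def)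
  show ?case
  proof (rule finitely_tested_dominated_limit[where s = "\<lambda>n z. \<Sum>i<n. indicator (X i) z" and w = "\<lambda>_. 1"])
    show "(\<lambda>n. \<Sum>i<n. indicator (X i) z) \<longlonglongrightarrow> (indicator (\<Union>i. X i) z :: real)" for z
      unfolding partial by (rule LIMSEQ_indicator_UN)
    show "\<bar>\<Sum>i<n. indicator (X i) z\<bar> \<le> (1 :: real)" for n z
      unfolding partial by (simp split: split_indicator)
  qed (use fin int in auto)
qed

proposition finitely_tested_integrable:
  assumes "integrable (M \<Otimes>\<^sub>M M) H"
  shows "finitely_tested M g H"
  using assms
proof (induction rule: integrable_induct)
  case (base X c)
  then show ?case
    using finitely_tested_cmult[OF finitely_tested_indicator, of X c] by (simp add: mult.commute)
next
  case (add H K)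
  then show ?case by (intro finitely_tested_add)
next
  case (lim H s)
  then show ?case
    by (intro finitely_tested_dominated_limit[of s H "\<lambda>z. 2 * \<bar>H z\<bar>"]) auto
qed

section \<open>From sets to densities\<close>

text \<open>
  The whole space is added to the test sets of \<open>W\<close> so that \<open>U\<close> has measure exactly \<open>\<integral> g\<close>.
\<close>

theorem quadratic_form_ge:
  assumes "atomless M" and W: "integrable (M \<Otimes>\<^sub>M M) W"
    and sets: "\<And>U. U \<in> sets M \<Longrightarrow> (LINT z:U \<times> U|M \<Otimes>\<^sub>M M. W z) \<ge> p * (measure M U)\<^sup>2"
  shows "(\<integral>z. W z * (g (fst z) * g (snd z)) \<partial>(M \<Otimes>\<^sub>M M)) \<ge> p * (\<integral>x. g x \<partial>M)\<^sup>2"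
proof (rule field_le_epsilon)
  fix e :: real assume "e > 0"
  then obtain F where F: "finite F" "F \<subseteq> sets M"
    "\<And>U. mimics M g F U \<Longrightarrow> \<bar>\<integral>z. W z * defect g U z \<partial>(M \<Otimes>\<^sub>M M)\<bar> \<le> e"
    using finitely_tested_integrable[OF W] unfolding finitely_tested_def by blast
  obtain U where U: "mimics M g (insert (space M) F) U"
    using ex_mimics[OF \<open>atomless M\<close> g_measurable, of "insert (space M) F"] F g_nonneg g_le_1 by auto
  then have Um [measurable]: "U \<in> sets M" and "measure M (U \<inter> space M) = (LINT x:space M|M. g x)"
    by (auto simp: mimics_def)
  then have Ug: "measure M U = (\<integral>x. g x \<partial>M)"
    by (simp add: set_integral_space integrable_const_bound[where B = 1] AE_I2 g_nonneg g_le_1)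
  note [measurable] = borel_measurable_integrable[OF W]
  have intU: "integrable (M \<Otimes>\<^sub>M M) (\<lambda>z. indicator (U \<times> U) z *\<^sub>R W z)"
    using W by (intro integrable_mult_indicator) auto
  have "W z * (g (fst z) * g (snd z)) = indicator (U \<times> U) z *\<^sub>R W z + W z * defect g U z" for z
    by (cases z) (simp add: defect_def indicator_times algebra_simps)
  then have "(\<integral>z. W z * (g (fst z) * g (snd z)) \<partial>(M \<Otimes>\<^sub>M M))
      = (LINT z:U \<times> U|M \<Otimes>\<^sub>M M. W z) + (\<integral>z. W z * defect g U z \<partial>(M \<Otimes>\<^sub>M M))"
    unfolding set_lebesgue_integral_def
    using Bochner_Integration.integral_add[OF intU integrable_mult_defect[OF W Um]] by simp
  moreover have "\<bar>\<integral>z. W z * defect g U z \<partial>(M \<Otimes>\<^sub>M M)\<bar> \<le> e"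
    using F(3) U mimics_subset by blast
  ultimately show "p * (\<integral>x. g x \<partial>M)\<^sup>2 \<le> (\<integral>z. W z * (g (fst z) * g (snd z)) \<partial>(M \<Otimes>\<^sub>M M)) + e"
    using sets[OF Um] unfolding Ug by linarith
qed

end

theorem theorem1:
  fixes M :: "'a measure" and p :: real
    and W :: "'a \<times> 'a \<Rightarrow> real" and f :: "'a \<Rightarrow> real"
  assumes "prob_space M"
    and "atomless M"
    and "p \<in> {0..1}"
    and "W \<in> borel_measurable (M \<Otimes>\<^sub>M M)"
    and "W \<in> space M \<times> space M \<rightarrow> {0..1}"
    and "\<And>x y. x \<in> space M \<Longrightarrow> y \<in> space M \<Longrightarrow> W (x, y) = W (y, x)"
    and "\<And>U. U \<in> sets M \<Longrightarrow>
           (LINT z:U \<times> U|M \<Otimes>\<^sub>M M. W z) \<ge> p * (measure M U)\<^sup>2"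
    and "f \<in> borel_measurable M"
    and "\<And>x. x \<in> space M \<Longrightarrow> f x \<ge> 0"
    and "bounded (f ` space M)"
  shows "(\<integral>(x, y). f x * W (x, y) * f y \<partial>(M \<Otimes>\<^sub>M M)) \<ge> p * (\<integral>x. \<bar>f x\<bar> \<partial>M)\<^sup>2"
proof -
  interpret prob_space M by fact
  \<comment> \<open>Both sides are homogeneous of degree 2 in \<open>f\<close>, so \<open>f\<close> may be divided by a bound.\<close>
  obtain c where c: "c > 0" "\<And>x. x \<in> space M \<Longrightarrow> f x \<le> c"
    using \<open>bounded (f ` space M)\<close> unfolding bounded_pos by fastforce
  let ?g = "\<lambda>x. f x / c"
  interpret fractional_set M ?g
    using assms(8,9) c by unfold_locales auto
  have "integrable (M \<Otimes>\<^sub>M M) W"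
    using assms(4,5) by (intro pair.P.integrable_const_bound[where B = 1])
      (auto intro!: AE_I2 simp: space_pair_measure Pi_iff)
  from quadratic_form_ge[OF assms(2) this assms(7)]
  have "c\<^sup>2 * (p * (\<integral>x. ?g x \<partial>M)\<^sup>2) \<le> c\<^sup>2 * (\<integral>z. W z * (?g (fst z) * ?g (snd z)) \<partial>(M \<Otimes>\<^sub>M M))"
    by (intro mult_left_mono) auto
  moreover have "c\<^sup>2 * (p * (\<integral>x. ?g x \<partial>M)\<^sup>2) = p * (\<integral>x. \<bar>f x\<bar> \<partial>M)\<^sup>2"
  proof -
    have "(\<integral>x. \<bar>f x\<bar> \<partial>M) = (\<integral>x. f x \<partial>M)"
      using assms(9) by (intro Bochner_Integration.integral_cong) auto
    then show ?thesis
      using c by (simp add: power_divide)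
  qed
  moreover have "c\<^sup>2 * (\<integral>z. W z * (?g (fst z) * ?g (snd z)) \<partial>(M \<Otimes>\<^sub>M M))
      = (\<integral>(x, y). f x * W (x, y) * f y \<partial>(M \<Otimes>\<^sub>M M))"
    unfolding integral_mult_right_zero[symmetric]
    using c by (intro Bochner_Integration.integral_cong) (auto simp: power2_eq_square)
  ultimately show ?thesis
    by (simp only:)
qed

end
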